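(* Let $P=(r,s)\in\mathbb{R}^2$ and let $b_{r,s}$ be the parametrized pedal curve of the bicorn with respect to the pole $P$. If the pedal curve $b_{r,s}$ has a non-trivial self-intersection, i.e. a point $Q$ for which there exist two distinct values $m,n\in[0,2\pi)$, $m\ne n$, with $b_{r,s}(m)=b_{r,s}(n)=Q$, then the self-intersection point is the pole: $Q=P=(r,s)$.
   Context: The bicorn is the plane curve parametrized by $$x(u)=\sin u,\qquad y(u)=\frac{\cos^2u}{2-\cos u},\qquad u\in[0,2\pi).$$ Its tangent line at the parameter $u$ is the line $L_u$ with equation $$(4-\cos u)\sin u\; x+(2-\cos u)^2\,y+(2\cos^2u+\cos u-4)=0$$ (this equation is also used as the definition of $L_u$ at the cusps $u=\pi/2,\,3\pi/2$). The pedal curve of the bicorn with respect to a point $P$ (called the pole) is the locus of the feet of the perpendiculars dropped from $P$ onto the tangent lines $L_u$. For $P=(r,s)$ it is parametrized by $b_{r,s}(u)$, $u\in[0,2\pi)$, the intersection of $L_u$ with the line through $P$ perpendicular to $L_u$; explicitly $b_{r,s}(u)=(x_{r,s}(u),y_{r,s}(u))$ with $$x_{r,s}(u)=\frac{\sin u(\cos u-4)(2\cos^2u+\cos u-4)+r(\cos u-2)^4+s\sin u(\cos u-4)(\cos u-2)^2}{9\cos^2u-40\cos u+32},$$ $$y_{r,s}(u)=\frac{s(\cos u-4)^2\sin^2u+r\sin u(\cos u-4)(\cos u-2)^2-(\cos u-2)^2(2\cos^2u+\cos u-4)}{9\cos^2u-40\cos u+32}.$$ *)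

theory Defs
  imports "HOL-Analysis.Analysis"
begin

definition bicorn :: "real \<Rightarrow> real \<times> real" where
  "bicorn u = (sin u, (cos u)\<^sup>2 / (2 - cos u))"

(* At the cusps u = pi / 2 and u = 3 * pi / 2 the derivative of bicorn vanishes;
   there the line is given by the same equation. *)
definition bicorn_tangent :: "real \<Rightarrow> (real \<times> real) set" where
  "bicorn_tangent u =
    {(x, y). (4 - cos u) * sin u * x + (2 - cos u)\<^sup>2 * y + (2 * (cos u)\<^sup>2 + cos u - 4) = 0}"

definition bicorn_normal :: "real \<Rightarrow> real \<times> real" where
  "bicorn_normal u = ((4 - cos u) * sin u, (2 - cos u)\<^sup>2)"

(* The foot of the perpendicular from (r, s) to bicorn_tangent u, see bicorn_pedal_foot;
   the denominator is positive by bicorn_normal_inner_pos. *)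
fun bicorn_pedal :: "real \<times> real \<Rightarrow> real \<Rightarrow> real \<times> real" where
  "bicorn_pedal (r, s) u =
    ((sin u * (cos u - 4) * (2 * (cos u)\<^sup>2 + cos u - 4) + r * (cos u - 2) ^ 4
        + s * sin u * (cos u - 4) * (cos u - 2)\<^sup>2)
       / (9 * (cos u)\<^sup>2 - 40 * cos u + 32),
     (s * (cos u - 4)\<^sup>2 * (sin u)\<^sup>2 + r * sin u * (cos u - 4) * (cos u - 2)\<^sup>2
        - (cos u - 2)\<^sup>2 * (2 * (cos u)\<^sup>2 + cos u - 4))
       / (9 * (cos u)\<^sup>2 - 40 * cos u + 32))"

lemma bicorn_in_tangent: "bicorn u \<in> bicorn_tangent u"
proof -
  have "2 - cos u \<noteq> 0" using cos_le_one[of u] by linarith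
  then have "(2 - cos u)\<^sup>2 * ((cos u)\<^sup>2 / (2 - cos u)) = (2 - cos u) * (cos u)\<^sup>2"
    by (simp add: power2_eq_square)
  moreover have "(4 - cos u) * sin u * sin u = (4 - cos u) * (1 - (cos u)\<^sup>2)"
    unfolding sin_squared_eq[symmetric] by (simp add: power2_eq_square)
  moreover have "(4 - c) * (1 - c\<^sup>2) + (2 - c) * c\<^sup>2 + (2 * c\<^sup>2 + c - 4) = 0" for c :: real
    by (simp add: algebra_simps power2_eq_square)
  ultimately show ?thesis
    unfolding bicorn_def bicorn_tangent_def mem_Collect_eq case_prod_conv by metis
qed

lemma bicorn_has_vector_derivative:
  "(bicorn has_vector_derivative
     (cos u, - cos u * sin u * (4 - cos u) / (2 - cos u)\<^sup>2)) (at u)"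
proof -
  have nz: "2 - cos u \<noteq> 0" using cos_le_one[of u] by linarith
  have "((\<lambda>u. (cos u)\<^sup>2 / (2 - cos u)) has_real_derivative
     - cos u * sin u * (4 - cos u) / (2 - cos u)\<^sup>2) (at u)"
    using nz
    by (auto intro!: derivative_eq_intros simp: divide_simps)
       (simp add: algebra_simps power2_eq_square)
  moreover have "(sin has_real_derivative cos u) (at u)"
    by (rule DERIV_sin)
  ultimately show ?thesis
    unfolding bicorn_def[abs_def] has_real_derivative_iff_has_vector_derivative
    by (intro has_vector_derivative_Pair)
qed

lemma bicorn_derivative_orthogonal_normal:
  "vector_derivative bicorn (at u) \<bullet> bicorn_normal u = 0"
proof -
  have "2 - cos u \<noteq> 0" using cos_le_one[of u] by linarith
  then show ?thesis
    by (simp add: vector_derivative_at[OF bicorn_has_vector_derivative] bicorn_normal_def inner_prod_def)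
qed

lemma bicorn_normal_inner_self:
  "bicorn_normal u \<bullet> bicorn_normal u = 9 * (cos u)\<^sup>2 - 40 * cos u + 32"
proof -
  have "((4 - cos u) * sin u) * ((4 - cos u) * sin u) = (4 - cos u)\<^sup>2 * (1 - (cos u)\<^sup>2)"
    unfolding sin_squared_eq[symmetric] by (simp add: power2_eq_square)
  then show ?thesis
    unfolding bicorn_normal_def
    by (simp add: inner_prod_def algebra_simps power2_eq_square)
qed

lemma bicorn_normal_inner_pos: "9 * (cos (u::real))\<^sup>2 - 40 * cos u + 32 > 0"
proof -
  have "2 - cos u > 0" using cos_le_one[of u] by linarith
  then have "bicorn_normal u \<noteq> 0"
    by (auto simp: bicorn_normal_def zero_prod_def)
  then show ?thesis
    by (simp flip: bicorn_normal_inner_self)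
qed

lemma bicorn_pedal_foot:
  "bicorn_tangent u \<inter> range (\<lambda>t. P + t *\<^sub>R bicorn_normal u) = {bicorn_pedal P u}"
proof -
  obtain r s where P: "P = (r, s)" by (cases P)
  define a b k N where "a = (4 - cos u) * sin u" and "b = (2 - cos u)\<^sup>2"
    and "k = 2 * (cos u)\<^sup>2 + cos u - 4" and "N = 9 * (cos u)\<^sup>2 - 40 * cos u + 32"
  have N: "N = a * a + b * b" and N0: "N \<noteq> 0"
    using bicorn_normal_inner_self[of u] bicorn_normal_inner_pos[of u]
    by (simp_all add: N_def a_def b_def bicorn_normal_def inner_prod_def)
  have norm: "bicorn_normal u = (a, b)" 
    by (simp add: bicorn_normal_def a_def b_def)
  have tan: "(x, y) \<in> bicorn_tangent u \<longleftrightarrow> a * x + b * y + k = 0" for x y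
    by (simp add: bicorn_tangent_def a_def b_def k_def)
  define t0 where "t0 = - (a * r + b * s + k) / N"
  have on: "P + t *\<^sub>R bicorn_normal u \<in> bicorn_tangent u \<longleftrightarrow> t = t0" for t
  proof -
    have "P + t *\<^sub>R bicorn_normal u \<in> bicorn_tangent u \<longleftrightarrow> N * t + (a * r + b * s + k) = 0"
      by (simp add: P norm tan N algebra_simps)
    also have "\<dots> \<longleftrightarrow> t = t0"
      using N0 by (auto simp: t0_def field_simps)
    finally show ?thesis .
  qed
  have e1: "sin u * (cos u - 4) = - a" and e2: "(cos u - 2)\<^sup>2 = b"
    by (simp_all add: a_def b_def algebra_simps power2_eq_square)
  have e3: "(cos u - 2) ^ 4 = b * b" and e4: "(cos u - 4)\<^sup>2 * (sin u)\<^sup>2 = a * a"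
    by (simp_all add: a_def b_def algebra_simps power2_eq_square power4_eq_xxxx)
  have "bicorn_pedal P u = ((sin u * (cos u - 4) * k + r * (cos u - 2) ^ 4
        + s * (sin u * (cos u - 4)) * (cos u - 2)\<^sup>2) / N,
     (s * ((cos u - 4)\<^sup>2 * (sin u)\<^sup>2) + r * (sin u * (cos u - 4)) * (cos u - 2)\<^sup>2
        - (cos u - 2)\<^sup>2 * k) / N)"
    by (simp add: P k_def N_def mult.assoc)
  also have "\<dots> = ((- a * k + r * (b * b) + s * - a * b) / N, (s * (a * a) + r * - a * b - b * k) / N)"
    unfolding e1 e2 e3 e4 ..
  also have "\<dots> = P + t0 *\<^sub>R bicorn_normal u"
  proof -
    have "r + t0 * a = (- a * k + r * (b * b) + s * - a * b) / N"
      "s + t0 * b = (s * (a * a) + r * - a * b - b * k) / N"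
      unfolding t0_def using N0
      by (simp_all add: eq_divide_eq distrib_right) (simp_all add: N algebra_simps)
    then show ?thesis by (simp add: P norm)
  qed
  finally have "bicorn_pedal P u = P + t0 *\<^sub>R bicorn_normal u" .
  with on show ?thesis by auto
qed

end

theory Submission
  imports Defs
begin

text \<open>
  A point \<open>Q \<noteq> P\<close> of the pedal curve determines the tangent line it comes from, namely the
  perpendicular to \<open>Q - P\<close> through \<open>Q\<close>. So a self-intersection away from the pole needs a
  line \<open>L\<^sub>m = L\<^sub>n\<close> with \<open>m \<noteq> n\<close>. With \<open>t = 1 / (2 - cos u)\<close>, the line \<open>L\<^sub>u\<close> has
  \<open>y\<close>-intercept \<open>- (6 t\<^sup>2 - 9 t + 2)\<close> and squared slope \<open>(2 t + 1)\<^sup>2 (3 t - 1) (1 - t)\<close>.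
  Equal intercepts at \<open>t \<noteq> e\<close> force \<open>t + e = 3/2\<close>, and then the squared slopes differ by
  \<open>64 (t - 3/4)\<^sup>3 \<noteq> 0\<close>. Hence \<open>L\<^sub>u\<close> determines \<open>cos u\<close>, and the sign of the slope
  determines \<open>sin u\<close>.
\<close>

lemma intercept_slope_inj:
  fixes t e :: real
  assumes "6 * t\<^sup>2 - 9 * t + 2 = 6 * e\<^sup>2 - 9 * e + 2"
    and "(2 * t + 1)\<^sup>2 * ((3 * t - 1) * (1 - t)) = (2 * e + 1)\<^sup>2 * ((3 * e - 1) * (1 - e))"
  shows "t = e"
proof (rule ccontr)
  assume ne: "t \<noteq> e"
  have "(t - e) * (6 * (t + e) - 9) = 0"
    using assms(1) by (simp add: algebra_simps power2_eq_square)
  with ne have e: "e = 3 / 2 - t" by simp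
  \<comment> \<open>With \<open>e = 3 / 2 - t\<close> the difference is odd in
    \<open>t - 3 / 4\<close>; its linear term happens to cancel.\<close>
  have "(2 * e + 1)\<^sup>2 * ((3 * e - 1) * (1 - e)) - (2 * t + 1)\<^sup>2 * ((3 * t - 1) * (1 - t))
      = 64 * (t - 3 / 4) ^ 3"
    unfolding e by (simp add: field_simps power2_eq_square power3_eq_cube)
  with assms(2) have "t = 3 / 4" by simp
  with e ne show False by simp
qed

text \<open>Substituting \<open>cos u = 2 - 1 / t\<close> makes the intercept polynomial in
  \<open>t\<close>; the slope must be squared to eliminate \<open>sin u\<close>.\<close>

lemma bicorn_tangent_coeffs:
  fixes u :: real
  defines "t \<equiv> 1 / (2 - cos u)"
  shows "(2 * (cos u)\<^sup>2 + cos u - 4) / (2 - cos u)\<^sup>2 = 6 * t\<^sup>2 - 9 * t + 2"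
    and "((4 - cos u) * sin u / (2 - cos u)\<^sup>2)\<^sup>2 = (2 * t + 1)\<^sup>2 * ((3 * t - 1) * (1 - t))"
proof -
  have nz: "2 - cos u \<noteq> 0" using cos_le_one[of u] by linarith
  show "(2 * (cos u)\<^sup>2 + cos u - 4) / (2 - cos u)\<^sup>2 = 6 * t\<^sup>2 - 9 * t + 2"
    unfolding t_def using nz by (simp add: divide_simps) (simp add: algebra_simps power2_eq_square)
  have "2 * t + 1 = (4 - cos u) / (2 - cos u)"
    "3 * t - 1 = (1 + cos u) / (2 - cos u)" "1 - t = (1 - cos u) / (2 - cos u)"
    unfolding t_def using nz by (simp_all add: field_simps)
  moreover have "(sin u)\<^sup>2 = (1 + cos u) * (1 - cos u)"
    unfolding sin_squared_eq by (simp add: algebra_simps power2_eq_square)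
  ultimately show "((4 - cos u) * sin u / (2 - cos u)\<^sup>2)\<^sup>2
      = (2 * t + 1)\<^sup>2 * ((3 * t - 1) * (1 - t))"
    by (simp add: power_divide power_mult_distrib power2_eq_square)
qed

lemma sin_cos_inj:
  fixes m n :: real
  assumes "m \<in> {0..<2 * pi}" "n \<in> {0..<2 * pi}" "sin m = sin n" "cos m = cos n"
  shows "m = n"
proof -
  obtain k :: int where k: "m = n + 2 * pi * k"
    using assms(3,4) sin_cos_eq_iff by blast
  have "m - n < 2 * pi" "- (2 * pi) < m - n"
    using assms(1,2) by auto
  then have "2 * pi * k < 2 * pi * 1" "2 * pi * (- 1) < 2 * pi * k"
    unfolding k by simp_all
  then have "real_of_int k < 1" "- 1 < real_of_int k"
    by (meson mult_less_cancel_left_pos pi_gt_zero mult_pos_pos zero_less_numeral)+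
  then have "k = 0" by linarith
  with k show ?thesis by simp
qed

lemma bicorn_tangent_inj:
  assumes "m \<in> {0..<2 * pi}" "n \<in> {0..<2 * pi}"
    and slope: "(4 - cos m) * sin m / (2 - cos m)\<^sup>2 = (4 - cos n) * sin n / (2 - cos n)\<^sup>2"
    and intercept: "(2 * (cos m)\<^sup>2 + cos m - 4) / (2 - cos m)\<^sup>2
      = (2 * (cos n)\<^sup>2 + cos n - 4) / (2 - cos n)\<^sup>2"
  shows "m = n"
proof -
  have "1 / (2 - cos m) = 1 / (2 - cos n)"
    using intercept arg_cong[OF slope, of "\<lambda>x. x\<^sup>2"]
    unfolding bicorn_tangent_coeffs by (rule intercept_slope_inj)
  then have c: "cos m = cos n" by simp
  \<comment> \<open>Squaring lost the sign of \<open>sin\<close>; the unsquared slope restores it,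
    its other factors being nonzero.\<close>
  have "2 - cos n \<noteq> 0" "4 - cos n \<noteq> 0" using cos_le_one[of n] by linarith+
  with slope have "sin m = sin n" unfolding c by simp
  with assms(1,2) show ?thesis using c by (rule sin_cos_inj)
qed

theorem proposition16:
  fixes r s :: real and Q :: "real \<times> real"
  assumes "\<exists>m\<in>{0..<2 * pi}. \<exists>n\<in>{0..<2 * pi}.
    m \<noteq> n \<and> bicorn_pedal (r, s) m = Q \<and> bicorn_pedal (r, s) n = Q"
  shows "Q = (r, s)"
proof (rule ccontr)
  assume neq: "Q \<noteq> (r, s)"
  obtain m n where mn: "m \<in> {0..<2 * pi}" "n \<in> {0..<2 * pi}" "m \<noteq> n"
    and Qm: "bicorn_pedal (r, s) m = Q" and Qn: "bicorn_pedal (r, s) n = Q"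
    using assms by blast
  obtain x y where Q: "Q = (x, y)" by (cases Q)
  \<comment> \<open>Scaling the coefficient of \<open>y\<close> to 1 makes the other two,
    \<open>A u\<close> and \<open>K u\<close>, depend only on the line.\<close>
  define A where "A u = (4 - cos u) * sin u / (2 - cos u)\<^sup>2" for u :: real
  define K where "K u = (2 * (cos u)\<^sup>2 + cos u - 4) / (2 - cos u)\<^sup>2" for u :: real
  have line: "A u * x + y + K u = 0 \<and> x - r = A u * (y - s) \<and> y \<noteq> s"
    if "bicorn_pedal (r, s) u = Q" for u
  proof -
    have b: "(2 - cos u)\<^sup>2 \<noteq> 0" using cos_le_one[of u] by (auto simp del: cos_le_one)
    have "Q \<in> bicorn_tangent u \<inter> range (\<lambda>t. (r, s) + t *\<^sub>R bicorn_normal u)"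
      unfolding bicorn_pedal_foot that by simp
    then obtain t where on: "(x, y) \<in> bicorn_tangent u"
      and "(x, y) = (r, s) + t *\<^sub>R bicorn_normal u"
      unfolding Q by blast
    then have t: "x - r = t * ((4 - cos u) * sin u)" "y - s = t * (2 - cos u)\<^sup>2"
      by (simp_all add: bicorn_normal_def)
    have "A u * x + y + K u = ((4 - cos u) * sin u * x + (2 - cos u)\<^sup>2 * y
        + (2 * (cos u)\<^sup>2 + cos u - 4)) / (2 - cos u)\<^sup>2"
      using b by (simp add: A_def K_def add_divide_distrib diff_divide_distrib)
    moreover have "x - r = A u * (y - s)"
      using b t by (simp add: A_def)
    \<comment> \<open>The normal is never horizontal, so \<open>y = s\<close> would put
      \<open>Q\<close> at the pole.\<close>
    moreover have "y \<noteq> s"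
      using neq t b by (auto simp: Q)
    ultimately show ?thesis
      using on by (simp add: bicorn_tangent_def)
  qed
  \<comment> \<open>Both sides equal \<open>x - r\<close>: the two normals are parallel to
    \<open>Q - P\<close>.\<close>
  have "A m * (y - s) = A n * (y - s)"
    using line[OF Qm] line[OF Qn] by simp
  then have A: "A m = A n" using line[OF Qm] by simp
  have "A m * x + y + K m = A n * x + y + K n"
    using line[OF Qm] line[OF Qn] by simp
  with A have "K m = K n" by simp
  with mn(1,2) A have "m = n"
    unfolding A_def K_def by (rule bicorn_tangent_inj)
  with mn(3) show False ..
qed

end
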